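(* Let $\{G_m\}_{m\in\mathbb Z}$ be a generalized Fibonacci sequence and let $m,n,r,k$ be integers. The following identities hold. (i) If $n\neq 0$ (and, in case $k\le -2$, also $n+r\ne 0$), then $$F_r\sum_{j=0}^k (-1)^{rj}\left(\frac{F_{n+r}}{F_n}\right)^j G_{m+n+r+rj} = (-1)^{kr}F_n\left(\frac{F_{n+r}}{F_n}\right)^{k+1}G_{m+(k+1)r}-(-1)^rF_nG_m .$$ (ii) If $n\neq 0$ (and, in case $k\le -2$, also $r\neq 0$), then $$F_{n+r}\sum_{j=0}^k (-1)^{(r+1)j}\left(\frac{F_r}{F_n}\right)^jG_{m+r+(n+r)j} = (-1)^rF_nG_m+(-1)^{(r+1)k}F_n\left(\frac{F_r}{F_n}\right)^{k+1}G_{m+(k+1)(n+r)} .$$ (iii) If $n\neq 0$ and $n+r\neq 0$ (and, in case $k\le -1$, also $r\neq 0$), then $$\sum_{j=0}^k\left(\frac{F_r}{F_{n+r}}\right)^jG_{m-r+nj} = (-1)^r\frac{F_{n+r}}{F_n}G_m-(-1)^r\frac{F_r}{F_n}\left(\frac{F_r}{F_{n+r}}\right)^kG_{m+(k+1)n} .$$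
   Context: A generalized Fibonacci sequence $\{G_m\}$ is defined by $G_m=G_{m-1}+G_{m-2}$ for $m\ge 2$, with arbitrary (say complex) initial values $G_0,G_1$. The case $G_0=0$, $G_1=1$ is the Fibonacci sequence $\{F_m\}$. Extension to negative indices is by $G_{-m}=(-1)^m(F_{m+1}G_0-F_mG_1)$ for $m\ge 1$, so that $G_m=G_{m-1}+G_{m-2}$ holds for all integers $m$ (in particular $F_{-m}=(-1)^{m+1}F_m$). Conventions: $x^0=1$ for every $x$, including $x=0$. For negative $k$, $\sum_{j=0}^k a_j$ is understood as $-\sum_{j=k+1}^{-1}a_j$ (so it is $0$ for $k=-1$). *)

theory Defs
  imports Complex_Main "HOL-Number_Theory.Fib"
begin

definition fibz :: "int \<Rightarrow> int" where
  "fibz m = (if m \<ge> 0 then int (fib (nat m))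
             else (- 1) ^ (nat (- m) + 1) * int (fib (nat (- m))))"

abbreviation F :: "int \<Rightarrow> complex" where
  "F m \<equiv> of_int (fibz m)"

(* The second conjunct is the rule that extends the sequence to negative indices;
   generalized_fibonacci_rec below shows that it amounts to the recurrence on all of the integers. *)
definition generalized_fibonacci :: "(int \<Rightarrow> complex) \<Rightarrow> bool" where
  "generalized_fibonacci G \<longleftrightarrow>
     (\<forall>m\<ge>2. G m = G (m - 1) + G (m - 2)) \<and>
     (\<forall>m\<ge>1. G (- m) = (- 1) powi m * (F (m + 1) * G 0 - F m * G 1))"

(* The sum over j = 0, ..., k for an arbitrary integer k, with the usual convention for
   negative k; for k = -1 the interval is empty and the value is 0. *)
definition sum_upto :: "(int \<Rightarrow> complex) \<Rightarrow> int \<Rightarrow> complex" where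
  "sum_upto a k = (if k \<ge> 0 then \<Sum>j\<in>{0..k}. a j else - (\<Sum>j\<in>{k + 1..- 1}. a j))"

lemma fibz_rec: "fibz m = fibz (m - 1) + fibz (m - 2)"
proof -
  consider "m \<ge> 2" | "m = 1" | "m = 0" | "m < 0" by linarith
  then show ?thesis
  proof cases
    case 1
    define k where "k = nat (m - 2)"
    have "m = int k + 2" using 1 by (simp add: k_def)
    moreover have "nat (int k + 2) = Suc (Suc k)" "nat (int k + 1) = Suc k"
      "nat (1 + int k) = Suc k" by auto
    ultimately show ?thesis by (simp add: fibz_def)
  next
    case 4
    define k where "k = nat (- m)"
    have "m = - int k" using 4 by (simp add: k_def)
    moreover have "k > 0" using 4 by (simp add: k_def)
    moreover have "nat (int k + 2) = Suc (Suc k)" "nat (int k + 1) = Suc k"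
      "nat (2 + int k) = Suc (Suc k)" "nat (1 + int k) = Suc k" by auto
    ultimately show ?thesis by (simp add: fibz_def algebra_simps)
  qed (simp_all add: fibz_def numeral_2_eq_2)
qed

lemma generalized_fibonacci_fibz: "generalized_fibonacci F"
  unfolding generalized_fibonacci_def
proof (intro conjI allI impI)
  fix m :: int
  show "of_int (fibz m) = (of_int (fibz (m - 1)) + of_int (fibz (m - 2)) :: complex)"
    by (subst fibz_rec) simp
  assume "m \<ge> 1"
  then show "of_int (fibz (- m)) = (- 1) powi m * (of_int (fibz (m + 1)) * of_int (fibz 0)
      - of_int (fibz m) * (of_int (fibz 1) :: complex))"
    by (simp add: fibz_def power_int_def)
qed

lemma generalized_fibonacci_rec:
  assumes "generalized_fibonacci G"
  shows "G m = G (m - 1) + G (m - 2)"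
proof -
  have pos: "G i = G (i - 1) + G (i - 2)" if "i \<ge> 2" for i
    using assms that by (simp add: generalized_fibonacci_def)
  have neg: "G (- i) = (- 1) powi i * (of_int (fibz (i + 1)) * G 0 - of_int (fibz i) * G 1)"
    if "i \<ge> 0" for i
    using assms that by (cases "i = 0") (simp_all add: generalized_fibonacci_def fibz_def)
  consider "m \<ge> 2" | "m = 1" | "m \<le> 0" by linarith
  then show ?thesis
  proof cases
    case 1
    then show ?thesis by (rule pos)
  next
    case 2
    then show ?thesis using neg[of 1] by (simp add: fibz_def numeral_2_eq_2)
  next
    case 3
    define i where "i = - m"
    have i: "i \<ge> 0" using 3 by (simp add: i_def)
    have p: "(- 1 :: complex) powi (i + 1) = - ((- 1) powi i)"
      "(- 1 :: complex) powi (i + 2) = (- 1) powi i"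
      by (simp_all add: power_int_add)
    have f: "fibz (i + 3) = fibz (i + 1) + fibz (i + 2)" "fibz (i + 2) = fibz i + fibz (i + 1)"
      using fibz_rec[of "i + 3"] fibz_rec[of "i + 2"] by (simp_all add: algebra_simps)
    have e: "m = - i" "m - 1 = - (i + 1)" "m - 2 = - (i + 2)" by (auto simp: i_def)
    have n: "G (- i) = (- 1) powi i * (of_int (fibz (i + 1)) * G 0 - of_int (fibz i) * G 1)"
      "G (- (i + 1)) = - ((- 1) powi i) * (of_int (fibz (i + 2)) * G 0 - of_int (fibz (i + 1)) * G 1)"
      "G (- (i + 2)) = (- 1) powi i * (of_int (fibz (i + 3)) * G 0 - of_int (fibz (i + 2)) * G 1)"
      using neg[of i] neg[of "i + 1"] neg[of "i + 2"] i by (simp_all only: p) (simp_all add: add.assoc)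
    show ?thesis unfolding e(2,3) unfolding e(1) n f of_int_add by (simp add: algebra_simps)
  qed
qed

end

theory Submission
  imports Defs
begin

text \<open>
  All three identities are geometric telescoping sums. For each of them there are a ratio
  \<open>x\<close> and a step \<open>d\<close> such that, up to a constant factor, the summand equals
  \<open>x\<^sup>j (x g(j+1) - g(j))\<close> with \<open>g(j) = G(m + d j)\<close>. By
  \<open>sum_upto_geometric_telescope\<close> the sum is then \<open>x\<^sup>k\<^sup>+\<^sup>1 g(k+1) - g(0)\<close>.

  The only number-theoretic input is the three-term relation \<open>fibonacci_three_term\<close>,
  \<open>F(r) G(M+n+r) = F(n+r) G(M+r) - (-1)\<^sup>r F(n) G(M)\<close>,
  between the terms of \<open>G\<close> at \<open>M\<close>, \<open>M + r\<close> and \<open>M + n + r\<close>. Each identity sums one of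
  these terms and telescopes the other two, whose distance is the step \<open>d\<close>: it is \<open>r\<close> when
  the term at \<open>M + n + r\<close> is summed, \<open>n + r\<close> when the one at \<open>M + r\<close> is, and \<open>n\<close> when the
  one at \<open>M\<close> is. The ratio \<open>x\<close> is the quotient of the two coefficients of the telescoping terms,
  with its sign.

  For fixed \<open>r\<close> and \<open>M\<close> both sides of the relation solve the Fibonacci recurrence in \<open>n\<close>, so
  it has to be checked only for \<open>n = 0\<close>, where it is trivial, and for \<open>n = 1\<close>, where it gives
  the Casoratian of \<open>F\<close> and a shift of \<open>G\<close> (\<open>fibonacci_casoratian\<close>).
\<close>

section \<open>The Fibonacci recurrence on the integers\<close>

lemma fibz_eq_0_iff: "fibz n = 0 \<longleftrightarrow> n = 0"
  using fib_neq_0_nat[of "nat n"] fib_neq_0_nat[of "nat (- n)"]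
  by (cases n "0 :: int" rule: linorder_cases) (auto simp: fibz_def)

lemma fibonacci_solution_eq_0:
  fixes H :: "int \<Rightarrow> 'a::ab_group_add"
  assumes rec: "\<And>i. H (i + 2) = H (i + 1) + H i" and "H 0 = 0" "H 1 = 0"
  shows "H i = 0"
proof -
  have "H i = 0 \<and> H (i + 1) = 0"
  proof (induction i rule: int_induct[where k = 0])
    case base
    then show ?case using assms by simp
  next
    case (step1 i)
    then show ?case using rec[of i] by (simp add: add.assoc)
  next
    case (step2 i)
    then show ?case using rec[of "i - 1"] by (simp add: add.commute)
  qed
  then show ?thesis by simp
qed

lemma generalized_fibonacci_add_2:
  assumes "generalized_fibonacci G"
  shows "G (i + 2) = G (i + 1) + G i"
  using generalized_fibonacci_rec[OF assms, of "i + 2"] by (simp add: add.commute)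

text \<open>The left-hand side is the Casoratian of the solutions \<open>F r\<close> and \<open>G (M + r)\<close>. Adding
  the recurrence shows that it is multiplied by \<open>-1\<close> when \<open>r\<close> grows by one, and at \<open>r = 0\<close> it
  is \<open>- G M\<close>. For \<open>G = F\<close>, \<open>M = 1\<close> this is Cassini's identity.\<close>

lemma fibonacci_casoratian:
  assumes "generalized_fibonacci G"
  shows "F r * G (M + r + 1) - F (r + 1) * G (M + r) = - ((- 1) powi r * G M)"
proof -
  note rec = generalized_fibonacci_add_2[OF generalized_fibonacci_fibz]
             generalized_fibonacci_add_2[OF assms]
  define W where "W r = F r * G (M + r + 1) - F (r + 1) * G (M + r)" for r
  have alternates: "W (r + 1) = - W r" for r
    using rec(1)[of r] rec(2)[of "M + r"]
    by (simp add: W_def algebra_simps)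
  have "W r = - ((- 1) powi r * G M)"
  proof (induction r rule: int_induct[where k = 0])
    case base
    then show ?case by (simp add: W_def fibz_def)
  next
    case (step1 i)
    then show ?case using alternates[of i] by (simp add: power_int_add)
  next
    case (step2 i)
    then show ?case using alternates[of "i - 1"] by (simp add: power_int_diff)
  qed
  then show ?thesis by (simp add: W_def)
qed

text \<open>Fixing \<open>r\<close> and \<open>M\<close> and letting \<open>n\<close> vary makes this linear: the difference of the two
  sides solves the recurrence in \<open>n\<close>, and it vanishes at \<open>0\<close> and, by the Casoratian, at \<open>1\<close>.\<close>

lemma fibonacci_three_term:
  assumes "generalized_fibonacci G"
  shows "F r * G (M + n + r) = F (n + r) * G (M + r) - (- 1) powi r * F n * G M"
proof -
  note rec = generalized_fibonacci_add_2[OF generalized_fibonacci_fibz]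
             generalized_fibonacci_add_2[OF assms]
  define H where
    "H n = F r * G (M + n + r) - F (n + r) * G (M + r) + (- 1) powi r * F n * G M" for n
  have "H n = 0"
  proof (rule fibonacci_solution_eq_0)
    show "H (i + 2) = H (i + 1) + H i" for i
      using rec(1)[of i] rec(1)[of "i + r"] rec(2)[of "M + i + r"]
      by (simp add: H_def algebra_simps)
    show "H 0 = 0" by (simp add: H_def fibz_def)
    show "H 1 = 0"
      using fibonacci_casoratian[OF assms, of r M] by (simp add: H_def fibz_def algebra_simps)
  qed
  then show ?thesis by (simp add: H_def algebra_simps)
qed

section \<open>Telescoping sums with an arbitrary integer upper limit\<close>

lemma sum_upto_telescope:
  assumes "\<And>j. 0 \<le> j \<and> j \<le> k \<or> k < j \<and> j < 0 \<Longrightarrow> a j = T (j + 1) - T j"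
  shows "sum_upto a k = T (k + 1) - T 0"
proof -
  have tele: "(\<Sum>j\<in>{u..v}. T (j + 1) - T j) = T (v + 1) - T u" if "u \<le> v + 1" for u v :: int
  proof -
    have "u - 1 \<le> v" using that by simp
    then show ?thesis
    proof (induction v rule: int_ge_induct)
      case base
      then show ?case by simp
    next
      case (step i)
      then have "{u..i + 1} = insert (i + 1) {u..i}" by auto
      then show ?case using step.IH by simp
    qed
  qed
  show ?thesis
  proof (cases "k \<ge> 0")
    case True
    then have "sum_upto a k = (\<Sum>j\<in>{0..k}. T (j + 1) - T j)"
      using assms by (auto simp: sum_upto_def intro!: sum.cong)
    then show ?thesis using tele[of 0 k] True by simp
  next
    case False
    then have "sum_upto a k = - (\<Sum>j\<in>{k + 1..- 1}. T (j + 1) - T j)"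
      using assms by (auto simp: sum_upto_def intro!: sum.cong)
    then show ?thesis using tele[of "k + 1" "- 1"] False by simp
  qed
qed

text \<open>The hypothesis on \<open>x\<close> is what \<open>x\<^sup>j\<^sup>+\<^sup>1 = x\<^sup>j x\<close> requires: at \<open>x = 0\<close> this law fails
  exactly for \<open>j = -1\<close>, an index that occurs in the sum exactly when \<open>k \<le> -2\<close>.\<close>

lemma sum_upto_geometric_telescope:
  assumes "k \<le> - 2 \<Longrightarrow> x \<noteq> 0"
    and summand: "\<And>j. c * a j = C * (x powi j * (x * g (j + 1) - g j))"
  shows "c * sum_upto a k = C * (x powi (k + 1) * g (k + 1) - g 0)"
proof -
  have "sum_upto (\<lambda>j. c * a j) k = C * (x powi (k + 1) * g (k + 1)) - C * (x powi 0 * g 0)"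
  proof (rule sum_upto_telescope)
    fix j
    assume j: "0 \<le> j \<and> j \<le> k \<or> k < j \<and> j < 0"
    have "x \<noteq> 0 \<or> j \<noteq> - 1" using j assms(1) by auto
    then have "x powi (j + 1) = x powi j * x" by (rule power_int_add_1)
    then show "c * a j = C * (x powi (j + 1) * g (j + 1)) - C * (x powi j * g j)"
      by (simp add: summand algebra_simps)
  qed
  moreover have "c * sum_upto a k = sum_upto (\<lambda>j. c * a j) k"
    by (simp add: sum_upto_def sum_distrib_left)
  ultimately show ?thesis by (simp add: algebra_simps)
qed

section \<open>The three sums\<close>

lemma minus_one_powi_square: "(- 1 :: complex) powi r * (- 1) powi r = 1"
  by (simp flip: power_int_mult_distrib)

text \<open>Here \<open>x = (-1)\<^sup>r F(n+r) / F(n)\<close>. The sign enters through \<open>s = (-1)\<^sup>r\<close> and \<open>s\<^sup>2 = 1\<close>, which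
  turns the coefficient \<open>F(n+r)\<close> into \<open>s F(n) x\<close>.\<close>

lemma sum_upto_step_r:
  assumes G: "generalized_fibonacci G" and n: "n \<noteq> 0" and k: "k \<le> - 2 \<Longrightarrow> n + r \<noteq> 0"
  shows "F r * sum_upto (\<lambda>j. (- 1) powi (r * j) * (F (n + r) / F n) powi j * G (m + n + r + r * j)) k
         = (- 1) powi (k * r) * F n * (F (n + r) / F n) powi (k + 1) * G (m + (k + 1) * r)
           - (- 1) powi r * F n * G m"
proof -
  define s where "s = (- 1 :: complex) powi r"
  define q where "q = F (n + r) / F n"
  have ss: "s * s = 1" by (simp add: s_def minus_one_powi_square)
  have Fn: "F n \<noteq> 0" using n by (simp add: fibz_eq_0_iff)
  have "F r * sum_upto (\<lambda>j. (s * q) powi j * G (m + n + r + r * j)) k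
        = s * F n * ((s * q) powi (k + 1) * G (m + r * (k + 1)) - G (m + r * 0))"
  proof (rule sum_upto_geometric_telescope)
    show "s * q \<noteq> 0" if "k \<le> - 2"
      using k[OF that] n by (simp add: s_def q_def fibz_eq_0_iff)
    fix j
    have "F r * G (m + n + r + r * j) = F (n + r) * G (m + r * (j + 1)) - s * F n * G (m + r * j)"
      using fibonacci_three_term[OF G, of r "m + r * j" n] by (simp add: s_def algebra_simps)
    also have "F (n + r) = s * F n * (s * q)"
      using ss Fn by (simp add: q_def mult_ac)
    finally have "F r * G (m + n + r + r * j)
        = s * F n * (s * q * G (m + r * (j + 1)) - G (m + r * j))"
      by (simp add: algebra_simps)
    then show "F r * ((s * q) powi j * G (m + n + r + r * j))
        = s * F n * ((s * q) powi j * (s * q * G (m + r * (j + 1)) - G (m + r * j)))"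
      by (simp add: mult_ac)
  qed
  moreover have "(s * q) powi j = (- 1) powi (r * j) * q powi j" for j
    by (simp add: s_def power_int_mult_distrib power_int_mult)
  moreover have "s * (- 1) powi (r * (k + 1)) = (- 1) powi (k * r)"
    using ss by (simp add: s_def distrib_left power_int_add mult_ac)
  ultimately show ?thesis
    by (simp add: s_def q_def right_diff_distrib mult_ac)
qed

text \<open>Here \<open>x = (-1)\<^sup>r\<^sup>+\<^sup>1 F(r) / F(n)\<close>. In terms of \<open>u = (-1)\<^sup>r\<^sup>+\<^sup>1\<close> the three-term relation is
  \<open>F(n+r) G(M+r) = F(r) G(M+n+r) - u F(n) G(M)\<close>, so \<open>u\<close> takes the place that \<open>(-1)\<^sup>r\<close>
  has in the sum with step \<open>r\<close>.\<close>

lemma sum_upto_step_n_plus_r: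
  assumes G: "generalized_fibonacci G" and n: "n \<noteq> 0" and k: "k \<le> - 2 \<Longrightarrow> r \<noteq> 0"
  shows "F (n + r) * sum_upto (\<lambda>j. (- 1) powi ((r + 1) * j) * (F r / F n) powi j * G (m + r + (n + r) * j)) k
         = (- 1) powi r * F n * G m
           + (- 1) powi ((r + 1) * k) * F n * (F r / F n) powi (k + 1) * G (m + (k + 1) * (n + r))"
proof -
  define u where "u = (- 1 :: complex) powi (r + 1)"
  define q where "q = F r / F n"
  have uu: "u * u = 1" by (simp only: u_def minus_one_powi_square)
  have sign: "(- 1) powi r = - u" by (simp add: u_def power_int_add)
  have Fn: "F n \<noteq> 0" using n by (simp add: fibz_eq_0_iff)
  have "F (n + r) * sum_upto (\<lambda>j. (u * q) powi j * G (m + r + (n + r) * j)) k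
        = u * F n * ((u * q) powi (k + 1) * G (m + (n + r) * (k + 1)) - G (m + (n + r) * 0))"
  proof (rule sum_upto_geometric_telescope)
    show "u * q \<noteq> 0" if "k \<le> - 2"
      using k[OF that] n by (simp add: u_def q_def fibz_eq_0_iff)
    fix j
    have "F (n + r) * G (m + r + (n + r) * j)
        = F r * G (m + (n + r) * (j + 1)) - u * F n * G (m + (n + r) * j)"
      using fibonacci_three_term[OF G, of r "m + (n + r) * j" n, unfolded sign]
      by (simp add: algebra_simps)
    also have "F r = u * F n * (u * q)"
      using uu Fn by (simp add: q_def mult_ac)
    finally have "F (n + r) * G (m + r + (n + r) * j)
        = u * F n * (u * q * G (m + (n + r) * (j + 1)) - G (m + (n + r) * j))"
      by (simp add: algebra_simps)
    then show "F (n + r) * ((u * q) powi j * G (m + r + (n + r) * j))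
        = u * F n * ((u * q) powi j * (u * q * G (m + (n + r) * (j + 1)) - G (m + (n + r) * j)))"
      by (simp add: mult_ac)
  qed
  moreover have "(u * q) powi j = (- 1) powi ((r + 1) * j) * q powi j" for j
    by (simp only: u_def power_int_mult_distrib power_int_mult)
  moreover have "u * (- 1) powi ((r + 1) * (k + 1)) = (- 1) powi ((r + 1) * k)"
  proof -
    have "(- 1) powi ((r + 1) * (k + 1)) = (- 1) powi ((r + 1) * k) * u"
      by (simp add: u_def distrib_left power_int_add)
    then show ?thesis using uu by (simp add: mult_ac)
  qed
  ultimately show ?thesis
    by (simp add: sign q_def right_diff_distrib mult_ac)
qed

text \<open>Here \<open>x = F(r) / F(n+r)\<close>. Telescoping yields \<open>F(n+r) x\<^sup>k\<^sup>+\<^sup>1\<close> where the closed form has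
  \<open>F(r) x\<^sup>k\<close>; for \<open>k = -1\<close> these agree only if \<open>x \<noteq> 0\<close>, hence \<open>r \<noteq> 0\<close> is needed already
  there.\<close>

lemma sum_upto_step_n:
  assumes G: "generalized_fibonacci G" and n: "n \<noteq> 0" "n + r \<noteq> 0" and k: "k \<le> - 1 \<Longrightarrow> r \<noteq> 0"
  shows "sum_upto (\<lambda>j. (F r / F (n + r)) powi j * G (m - r + n * j)) k
         = (- 1) powi r * (F (n + r) / F n) * G m
           - (- 1) powi r * (F r / F n) * (F r / F (n + r)) powi k * G (m + (k + 1) * n)"
proof -
  define s where "s = (- 1 :: complex) powi r"
  define q where "q = F r / F (n + r)"
  have ss: "s * s = 1" by (simp add: s_def minus_one_powi_square)
  have Fn: "F n \<noteq> 0" "F (n + r) \<noteq> 0" using n by (simp_all add: fibz_eq_0_iff)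
  have "1 * sum_upto (\<lambda>j. q powi j * G (m - r + n * j)) k
        = - (s * F (n + r) / F n) * (q powi (k + 1) * G (m + n * (k + 1)) - G (m + n * 0))"
  proof (rule sum_upto_geometric_telescope)
    show "q \<noteq> 0" if "k \<le> - 2"
      using k that n by (simp add: q_def fibz_eq_0_iff)
    fix j
    have "s * F n * G (m - r + n * j)
        = F (n + r) * G (m + n * j) - F r * G (m + n * (j + 1))"
      using fibonacci_three_term[OF G, of r "m - r + n * j" n] by (simp add: s_def algebra_simps)
    also have "F r = F (n + r) * q"
      using Fn by (simp add: q_def)
    finally have "s * F n * G (m - r + n * j)
        = - F (n + r) * (q * G (m + n * (j + 1)) - G (m + n * j))"
      by (simp add: algebra_simps)
    then have "s * s * (F n * G (m - r + n * j))
        = s * (- F (n + r) * (q * G (m + n * (j + 1)) - G (m + n * j)))"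
      by (simp only: mult.assoc)
    then have "F n * G (m - r + n * j)
        = s * (- F (n + r) * (q * G (m + n * (j + 1)) - G (m + n * j)))"
      by (simp only: ss mult_1)
    then have "G (m - r + n * j)
        = - (s * F (n + r) / F n) * (q * G (m + n * (j + 1)) - G (m + n * j))"
      using Fn by (simp add: field_simps)
    then show "1 * (q powi j * G (m - r + n * j))
        = - (s * F (n + r) / F n) * (q powi j * (q * G (m + n * (j + 1)) - G (m + n * j)))"
      by (metis mult.left_commute mult_1)
  qed
  moreover have "s * F (n + r) / F n * (q powi (k + 1) * G (m + n * (k + 1)))
      = s * (F r / F n) * q powi k * G (m + n * (k + 1))"
  proof -
    have "q \<noteq> 0 \<or> k \<noteq> - 1"
      using k n by (auto simp: q_def fibz_eq_0_iff)
    then have "q powi (k + 1) = q powi k * q" by (rule power_int_add_1)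
    then show ?thesis using Fn by (simp add: q_def)
  qed
  ultimately show ?thesis
    by (simp add: s_def q_def right_diff_distrib mult_ac)
qed

theorem theorem1:
  fixes G :: "int \<Rightarrow> complex" and m n r k :: int
  assumes "generalized_fibonacci G"
  shows "(n \<noteq> 0 \<and> (k \<le> - 2 \<longrightarrow> n + r \<noteq> 0) \<longrightarrow>
           F r * sum_upto (\<lambda>j. (- 1) powi (r * j) * (F (n + r) / F n) powi j * G (m + n + r + r * j)) k
           = (- 1) powi (k * r) * F n * (F (n + r) / F n) powi (k + 1) * G (m + (k + 1) * r)
             - (- 1) powi r * F n * G m) \<and>
         (n \<noteq> 0 \<and> (k \<le> - 2 \<longrightarrow> r \<noteq> 0) \<longrightarrow>
           F (n + r) * sum_upto (\<lambda>j. (- 1) powi ((r + 1) * j) * (F r / F n) powi j * G (m + r + (n + r) * j)) k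
           = (- 1) powi r * F n * G m
             + (- 1) powi ((r + 1) * k) * F n * (F r / F n) powi (k + 1) * G (m + (k + 1) * (n + r))) \<and>
         (n \<noteq> 0 \<and> n + r \<noteq> 0 \<and> (k \<le> - 1 \<longrightarrow> r \<noteq> 0) \<longrightarrow>
           sum_upto (\<lambda>j. (F r / F (n + r)) powi j * G (m - r + n * j)) k
           = (- 1) powi r * (F (n + r) / F n) * G m
             - (- 1) powi r * (F r / F n) * (F r / F (n + r)) powi k * G (m + (k + 1) * n))"
  using sum_upto_step_r[OF assms, of n k r m] sum_upto_step_n_plus_r[OF assms, of n k r m]
    sum_upto_step_n[OF assms, of n r k m] by blast

end
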